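(* Let $\Sigma$ be a finite non-empty alphabet and, for $x,y\in\widetilde{\Sigma}^*$, write $x\preceq y$ if there exists $p\in\widetilde{\Sigma}^*$ with $y=x\cdot p$. Then: (i) $\preceq$ is a preorder on $\widetilde{\Sigma}^*$ (reflexive and transitive), and it is compatible with left multiplication: $x\preceq y$ implies $q x\preceq q y$ for every $q\in\widetilde{\Sigma}^*$. (ii) For $u,v\in\Sigma^*$, $\iota(u)\preceq\iota(v)$ if and only if $u$ is a prefix of $v$. (iii) If $\Sigma=\{a,b\}$, then $\preceq$ is not antisymmetric. (iv) If $\Sigma=\{a,b\}$, then $\preceq$ is not compatible with right multiplication: $\iota(a)\preceq\iota(ab)$ but $\iota(aa)\not\preceq\iota(aba)$.
   Context: $\Sigma^*$ is the free monoid of finite words over $\Sigma$ under concatenation, $\lambda$ is the empty word, $|w|$ is the length of $w$. For $u\neq v$ in $\Sigma^*$, $\operatorname{lcp}(u,v)$ and $\operatorname{lcs}(u,v)$ are the lengths of the longest common prefix and of the longest common suffix of $u,v$; by convention $\operatorname{lcp}(u,u)=\operatorname{lcs}(u,u)=+\infty$. A net of words is a family $(w_\varepsilon)_{\varepsilon\in(0,1]}$ of words in $\Sigma^*$. It is moderate if there exist $N\in\mathbb{N}$, $C>0$, $\varepsilon_0>0$ with $|w_\varepsilon|\le C\varepsilon^{-N}$ for all $\varepsilon<\varepsilon_0$. $\mathcal{E}_M(\Sigma^* )$ is the set of moderate nets. Two moderate nets are equivalent, $(u_\varepsilon)\sim(v_\varepsilon)$, if for every $m\in\mathbb{N}$ there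 exists $\varepsilon_0>0$ such that $\min\{\operatorname{lcp}(u_\varepsilon,v_\varepsilon),\operatorname{lcs}(u_\varepsilon,v_\varepsilon)\}\ge m\log_2(1/\varepsilon)$ for all $\varepsilon<\varepsilon_0$; this is an equivalence relation. $\widetilde{\Sigma}^*:=\mathcal{E}_M(\Sigma^* )/\sim$ is a monoid under the well-defined product $[(u_\varepsilon)]\cdot[(v_\varepsilon)]:=[(u_\varepsilon v_\varepsilon)]$, with identity $\mathbf{1}=[(\lambda)_\varepsilon]$. For $w\in\Sigma^*$, $\iota(w)\in\widetilde{\Sigma}^*$ is the class of the constant net equal to $w$. *)

theory Defs
  imports Complex_Main "HOL-Library.Sublist" "HOL-Library.Extended_Real"
begin

definition lcp :: "'a list \<Rightarrow> 'a list \<Rightarrow> enat" where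
  "lcp u v = (if u = v then \<infinity> else enat (length (longest_common_prefix u v)))"

definition lcs :: "'a list \<Rightarrow> 'a list \<Rightarrow> enat" where
  "lcs u v = (if u = v then \<infinity> else enat (Max {length s | s. suffix s u \<and> suffix s v}))"

text \<open>Nets are total functions on the reals of which only the values on \<open>{0<..1}\<close> matter:
  both predicates below look only at those values, so the quotient is the one of families
  indexed by \<open>{0<..1}\<close>.\<close>

type_synonym 'a net = "real \<Rightarrow> 'a list"

definition moderate :: "'a net \<Rightarrow> bool" where
  "moderate w \<longleftrightarrow> (\<exists>(N::nat) C \<epsilon>\<^sub>0. C > 0 \<and> \<epsilon>\<^sub>0 > 0 \<and>
     (\<forall>\<epsilon>\<in>{0<..1}. \<epsilon> < \<epsilon>\<^sub>0 \<longrightarrow> real (length (w \<epsilon>)) \<le> C / \<epsilon> ^ N))"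

definition net_equiv :: "'a net \<Rightarrow> 'a net \<Rightarrow> bool" where
  "net_equiv u v \<longleftrightarrow> (\<forall>m::nat. \<exists>\<epsilon>\<^sub>0>0. \<forall>\<epsilon>\<in>{0<..1}. \<epsilon> < \<epsilon>\<^sub>0 \<longrightarrow>
     ereal_of_enat (min (lcp (u \<epsilon>) (v \<epsilon>)) (lcs (u \<epsilon>) (v \<epsilon>))) \<ge> ereal (real m * log 2 (1 / \<epsilon>)))"

lemma prefix_longest_common_prefix_iff:
  "prefix p (longest_common_prefix u v) \<longleftrightarrow> prefix p u \<and> prefix p v"
  by (meson longest_common_prefix_max_prefix longest_common_prefix_prefix1
      longest_common_prefix_prefix2 prefix_order.trans)

lemma enat_le_lcp_iff:
  "enat k \<le> lcp u v \<longleftrightarrow> u = v \<or> (\<exists>p. length p = k \<and> prefix p u \<and> prefix p v)"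
proof -
  have "k \<le> length (longest_common_prefix u v) \<longleftrightarrow> (\<exists>p. length p = k \<and> prefix p u \<and> prefix p v)"
  proof
    assume "k \<le> length (longest_common_prefix u v)"
    then have "length (take k (longest_common_prefix u v)) = k" by simp
    moreover have "prefix (take k (longest_common_prefix u v)) (longest_common_prefix u v)"
      by (rule take_is_prefix)
    ultimately show "\<exists>p. length p = k \<and> prefix p u \<and> prefix p v"
      unfolding prefix_longest_common_prefix_iff by blast
  next
    assume "\<exists>p. length p = k \<and> prefix p u \<and> prefix p v"
    then show "k \<le> length (longest_common_prefix u v)"
      using prefix_longest_common_prefix_iff prefix_length_le by metis
  qed
  then show ?thesis by (simp add: lcp_def)
qed

lemma lcs_eq_lcp_rev: "lcs u v = lcp (rev u) (rev v)"
proof -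
  have "Max {length s | s. suffix s u \<and> suffix s v} = length (longest_common_prefix (rev u) (rev v))"
  proof (rule Max_eqI)
    have "{length s | s. suffix s u \<and> suffix s v} \<subseteq> {..length u}"
      using suffix_length_le by fastforce
    then show "finite {length s | s. suffix s u \<and> suffix s v}"
      by (rule finite_subset) simp
  next
    fix y assume "y \<in> {length s | s. suffix s u \<and> suffix s v}"
    then obtain s where "y = length s" "prefix (rev s) (longest_common_prefix (rev u) (rev v))"
      by (auto simp: suffix_to_prefix prefix_longest_common_prefix_iff)
    then show "y \<le> length (longest_common_prefix (rev u) (rev v))"
      using prefix_length_le by fastforce
  next
    let ?s = "rev (longest_common_prefix (rev u) (rev v))"
    have "suffix ?s u" "suffix ?s v"
      by (simp_all add: suffix_to_prefix longest_common_prefix_prefix1 longest_common_prefix_prefix2)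
    then show "length (longest_common_prefix (rev u) (rev v)) \<in> {length s | s. suffix s u \<and> suffix s v}"
      by (metis (mono_tags, lifting) length_rev mem_Collect_eq)
  qed
  then show ?thesis by (simp add: lcs_def lcp_def)
qed

lemma lcp_refl [simp]: "lcp u u = \<infinity>" and lcs_refl [simp]: "lcs u u = \<infinity>"
  by (simp_all add: lcp_def lcs_def)

lemma enat_le_if: "(\<And>k. enat k \<le> x \<Longrightarrow> enat k \<le> y) \<Longrightarrow> x \<le> y" for x y :: enat
  by (cases x; cases y) (auto, metis Suc_n_not_le_n)

lemma lcp_sym: "lcp u v = lcp v u"
  by (rule antisym; rule enat_le_if) (auto simp: enat_le_lcp_iff)

lemma lcp_trans: "min (lcp u v) (lcp v w) \<le> lcp u w"
proof (rule enat_le_if)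
  fix k assume "enat k \<le> min (lcp u v) (lcp v w)"
  then have "enat k \<le> lcp u v" "enat k \<le> lcp v w" by auto
  then show "enat k \<le> lcp u w"
    unfolding enat_le_lcp_iff by (metis prefix_length_prefix prefix_order.antisym order_refl)
qed

lemma lcp_append: "min (lcp u u') (lcp v v') \<le> lcp (u @ v) (u' @ v')"
proof (rule enat_le_if)
  fix k assume "enat k \<le> min (lcp u u') (lcp v v')"
  then have *: "enat k \<le> lcp u u'" "enat k \<le> lcp v v'" by auto
  show "enat k \<le> lcp (u @ v) (u' @ v')"
  proof (cases "u = u'")
    case False
    then show ?thesis using *(1) unfolding enat_le_lcp_iff by (metis prefix_prefix)
  next
    case True
    show ?thesis
    proof (cases "v = v'")
      case False
      with *(2) obtain p where p: "length p = k" "prefix p v" "prefix p v'"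
        unfolding enat_le_lcp_iff by blast
      have "length (take k (u @ p)) = k" using p by simp
      moreover have "prefix (take k (u @ p)) (u @ v)" "prefix (take k (u @ p)) (u @ v')"
        using p by (meson same_prefix_prefix take_is_prefix prefix_order.trans)+
      ultimately show ?thesis unfolding enat_le_lcp_iff True by blast
    qed (simp add: True)
  qed
qed

abbreviation (input) lcps :: "'a list \<Rightarrow> 'a list \<Rightarrow> enat" where
  "lcps u v \<equiv> min (lcp u v) (lcs u v)"

lemma lcps_trans: "min (lcps u v) (lcps v w) \<le> lcps u w"
  using lcp_trans[of u v w] lcp_trans[of "rev u" "rev v" "rev w"]
  unfolding lcs_eq_lcp_rev by (auto simp: min_le_iff_disj)

lemma lcps_append: "min (lcps u u') (lcps v v') \<le> lcps (u @ v) (u' @ v')"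
  using lcp_append[of u u' v v'] lcp_append[of "rev v" "rev v'" "rev u" "rev u'"]
  unfolding lcs_eq_lcp_rev rev_append by (auto simp: min_le_iff_disj)

lemma net_equiv_refl: "net_equiv u u"
  unfolding net_equiv_def by (auto intro: exI[of _ 1])

lemma net_equiv_sym: "net_equiv u v \<Longrightarrow> net_equiv v u"
  unfolding net_equiv_def lcs_eq_lcp_rev by (simp add: lcp_sym)

lemma net_equiv_combine:
  assumes "net_equiv u v" "net_equiv u' v'"
    and le: "\<And>\<epsilon>. min (lcps (u \<epsilon>) (v \<epsilon>)) (lcps (u' \<epsilon>) (v' \<epsilon>)) \<le> lcps (f \<epsilon>) (g \<epsilon>)"
  shows "net_equiv f g"
  unfolding net_equiv_def
proof
  fix m :: nat
  from assms(1) obtain d where d: "d > 0" "\<forall>\<epsilon>\<in>{0<..1}. \<epsilon> < d \<longrightarrow>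
      ereal_of_enat (lcps (u \<epsilon>) (v \<epsilon>)) \<ge> ereal (real m * log 2 (1 / \<epsilon>))"
    unfolding net_equiv_def by blast
  from assms(2) obtain d' where d': "d' > 0" "\<forall>\<epsilon>\<in>{0<..1}. \<epsilon> < d' \<longrightarrow>
      ereal_of_enat (lcps (u' \<epsilon>) (v' \<epsilon>)) \<ge> ereal (real m * log 2 (1 / \<epsilon>))"
    unfolding net_equiv_def by blast
  have "ereal_of_enat (lcps (f \<epsilon>) (g \<epsilon>)) \<ge> ereal (real m * log 2 (1 / \<epsilon>))"
    if "\<epsilon> \<in> {0<..1}" "\<epsilon> < min d d'" for \<epsilon>
  proof -
    have "ereal (real m * log 2 (1 / \<epsilon>)) \<le> ereal_of_enat (lcps (u \<epsilon>) (v \<epsilon>))"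
      "ereal (real m * log 2 (1 / \<epsilon>)) \<le> ereal_of_enat (lcps (u' \<epsilon>) (v' \<epsilon>))"
      using d(2) d'(2) that by auto
    then have "ereal (real m * log 2 (1 / \<epsilon>))
        \<le> ereal_of_enat (min (lcps (u \<epsilon>) (v \<epsilon>)) (lcps (u' \<epsilon>) (v' \<epsilon>)))"
      by (simp add: min_def)
    also have "\<dots> \<le> ereal_of_enat (lcps (f \<epsilon>) (g \<epsilon>))"
      using le by (simp only: ereal_of_enat_le_iff)
    finally show ?thesis .
  qed
  with d(1) d'(1) show "\<exists>\<epsilon>\<^sub>0>0. \<forall>\<epsilon>\<in>{0<..1}. \<epsilon> < \<epsilon>\<^sub>0 \<longrightarrow>
     ereal_of_enat (lcps (f \<epsilon>) (g \<epsilon>)) \<ge> ereal (real m * log 2 (1 / \<epsilon>))"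
    by (intro exI[of _ "min d d'"]) simp
qed

lemma net_equiv_trans: "net_equiv u v \<Longrightarrow> net_equiv v w \<Longrightarrow> net_equiv u w"
  by (erule net_equiv_combine, assumption, rule lcps_trans)

lemma net_equiv_append:
  "net_equiv u u' \<Longrightarrow> net_equiv v v' \<Longrightarrow> net_equiv (\<lambda>\<epsilon>. u \<epsilon> @ v \<epsilon>) (\<lambda>\<epsilon>. u' \<epsilon> @ v' \<epsilon>)"
  by (erule net_equiv_combine, assumption, rule lcps_append)

lemma moderate_const: "moderate (\<lambda>_. w)"
  unfolding moderate_def
  by (intro exI[of _ 0] exI[of _ "real (length w) + 1"] exI[of _ 1]) auto

lemma moderate_append:
  assumes "moderate u" "moderate v"
  shows "moderate (\<lambda>\<epsilon>. u \<epsilon> @ v \<epsilon>)"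
proof -
  from assms(1) obtain N :: nat and C d where u: "C > 0" "d > 0"
    "\<forall>\<epsilon>\<in>{0<..1}. \<epsilon> < d \<longrightarrow> real (length (u \<epsilon>)) \<le> C / \<epsilon> ^ N"
    unfolding moderate_def by blast
  from assms(2) obtain M :: nat and D e where v: "D > 0" "e > 0"
    "\<forall>\<epsilon>\<in>{0<..1}. \<epsilon> < e \<longrightarrow> real (length (v \<epsilon>)) \<le> D / \<epsilon> ^ M"
    unfolding moderate_def by blast
  have "real (length (u \<epsilon> @ v \<epsilon>)) \<le> (C + D) / \<epsilon> ^ (N + M)"
    if "\<epsilon> \<in> {0<..1}" "\<epsilon> < min d e" for \<epsilon>
  proof -
    have "\<epsilon> ^ (N + M) \<le> \<epsilon> ^ N" "\<epsilon> ^ (N + M) \<le> \<epsilon> ^ M" "0 < \<epsilon> ^ (N + M)"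
      using that by (auto intro: power_decreasing)
    then have "C / \<epsilon> ^ N \<le> C / \<epsilon> ^ (N + M)" "D / \<epsilon> ^ M \<le> D / \<epsilon> ^ (N + M)"
      using u(1) v(1) that by (auto intro!: divide_left_mono)
    moreover have "real (length (u \<epsilon>)) \<le> C / \<epsilon> ^ N" "real (length (v \<epsilon>)) \<le> D / \<epsilon> ^ M"
      using u(3) v(3) that by auto
    ultimately show ?thesis by (simp add: add_divide_distrib)
  qed
  with u(1,2) v(1,2) show ?thesis
    unfolding moderate_def
    by (intro exI[of _ "N + M"] exI[of _ "C + D"] exI[of _ "min d e"]) simp
qed

definition moderate_equiv :: "'a net \<Rightarrow> 'a net \<Rightarrow> bool" where
  "moderate_equiv u v \<longleftrightarrow> moderate u \<and> moderate v \<and> net_equiv u v"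

quotient_type 'a gen_word = "'a net" / partial: moderate_equiv
proof (rule part_equivpI)
  show "\<exists>u. moderate_equiv u (u :: 'a net)"
    using moderate_const net_equiv_refl unfolding moderate_equiv_def by blast
  show "symp (moderate_equiv :: 'a net \<Rightarrow> _)"
    using net_equiv_sym unfolding moderate_equiv_def symp_def by blast
  show "transp (moderate_equiv :: 'a net \<Rightarrow> _)"
    using net_equiv_trans unfolding moderate_equiv_def transp_def by blast
qed

lift_definition embed :: "'a list \<Rightarrow> 'a gen_word" ("\<iota>") is "\<lambda>w _. w"
  by (simp add: moderate_equiv_def moderate_const net_equiv_refl)

instantiation gen_word :: (type) monoid_mult
begin

lift_definition one_gen_word :: "'a gen_word" is "\<lambda>_. []"
  by (simp add: moderate_equiv_def moderate_const net_equiv_refl)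

lift_definition times_gen_word :: "'a gen_word \<Rightarrow> 'a gen_word \<Rightarrow> 'a gen_word"
  is "\<lambda>u v \<epsilon>. u \<epsilon> @ v \<epsilon>"
  by (simp add: moderate_equiv_def moderate_append net_equiv_append)

instance
  by standard
    (transfer, simp add: moderate_equiv_def moderate_append moderate_const net_equiv_refl)+

end

definition gen_prefix :: "'a gen_word \<Rightarrow> 'a gen_word \<Rightarrow> bool" (infix "\<preceq>" 50) where
  "x \<preceq> y \<longleftrightarrow> (\<exists>p. y = x * p)"

end

theory Submission
  imports Defs "HOL-Real_Asymp.Real_Asymp"
begin

text \<open>
  Two moderate nets are identified as soon as they share prefixes and suffixes whose lengths
  outgrow every multiple of \<open>log 2 (1 / \<epsilon>)\<close>; the middle of a long word is therefore invisible.
  At the other extreme, a net of words of bounded length cannot share such long affixes with a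
  different word, so its equivalence class fixes its values for small \<open>\<epsilon>\<close>.

  Bounded words give part (ii): if the constant nets satisfy \<open>\<iota> v = \<iota> u * p\<close>, then \<open>v\<close> equals
  \<open>u @ p \<epsilon>\<close> at some small \<open>\<epsilon>\<close> (lemma \<open>net_equiv_imp_eq\<close>), so \<open>u\<close> is a prefix of \<open>v\<close>.
  Part (iv) is the observation that appending \<open>a\<close> to \<open>a\<close> and \<open>ab\<close> destroys the prefix relation
  between words.

  Long words give part (iii).  Let \<open>x\<close> be the class of \<open>a\<^sup>n\<close> with \<open>n = \<lceil>1 / \<epsilon>\<rceil>\<close>, which is moderate
  and grows faster than any multiple of the logarithm.  Then \<open>x * b * x = x\<close>, because the single
  \<open>b\<close> is hidden between two long blocks of \<open>a\<close>; hence \<open>x\<close> and \<open>x * b\<close> precede each other.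
  They differ because their last letters do.
\<close>

lemma lcp_le_length:
  assumes "u \<noteq> v"
  shows "lcp u v \<le> enat (length u)"
  using assms prefix_length_le[OF longest_common_prefix_prefix1[of u v]] by (simp add: lcp_def)

text \<open>The bound \<open>log 2 (1 / \<epsilon>)\<close> eventually exceeds any fixed length, so it can only be met by the
  conventional value \<open>\<infinity>\<close>, that is, by equality.\<close>

lemma net_equiv_imp_eq:
  assumes "net_equiv u v"
    and bounded: "\<And>\<epsilon>. u \<epsilon> \<noteq> v \<epsilon> \<Longrightarrow> min (lcp (u \<epsilon>) (v \<epsilon>)) (lcs (u \<epsilon>) (v \<epsilon>)) \<le> enat k"
  obtains \<epsilon> where "u \<epsilon> = v \<epsilon>"
proof -
  obtain d where "d > 0" and d: "\<And>\<epsilon>. \<epsilon> \<in> {0<..1} \<Longrightarrow> \<epsilon> < d \<Longrightarrow>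
      ereal (log 2 (1 / \<epsilon>)) \<le> ereal_of_enat (min (lcp (u \<epsilon>) (v \<epsilon>)) (lcs (u \<epsilon>) (v \<epsilon>)))"
    using assms(1) unfolding net_equiv_def by (metis mult_1 of_nat_1)
  have "eventually (\<lambda>\<epsilon>. real k < log 2 (1 / \<epsilon>)) (at_right 0)"
    by real_asymp
  moreover have "eventually (\<lambda>\<epsilon>. \<epsilon> \<in> {0<..<min d 1}) (at_right (0::real))"
    using \<open>d > 0\<close> by (intro eventually_at_right_real) auto
  ultimately have "eventually (\<lambda>\<epsilon>. real k < log 2 (1 / \<epsilon>) \<and> \<epsilon> \<in> {0<..<min d 1}) (at_right 0)"
    by (rule eventually_conj)
  then obtain \<epsilon> where \<epsilon>: "real k < log 2 (1 / \<epsilon>)" "\<epsilon> \<in> {0<..<min d 1}"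
    using eventually_happens trivial_limit_at_right_real by blast
  have "u \<epsilon> = v \<epsilon>"
  proof (rule ccontr)
    assume "u \<epsilon> \<noteq> v \<epsilon>"
    then have "ereal_of_enat (min (lcp (u \<epsilon>) (v \<epsilon>)) (lcs (u \<epsilon>) (v \<epsilon>))) \<le> ereal_of_enat (enat k)"
      unfolding ereal_of_enat_le_iff by (rule bounded)
    moreover have "ereal (log 2 (1 / \<epsilon>)) \<le> ereal_of_enat (min (lcp (u \<epsilon>) (v \<epsilon>)) (lcs (u \<epsilon>) (v \<epsilon>)))"
      using \<epsilon>(2) by (intro d) auto
    ultimately have "ereal (log 2 (1 / \<epsilon>)) \<le> ereal_of_enat (enat k)"
      by (rule order_trans[rotated])
    then show False
      using \<epsilon>(1) by simp
  qed
  then show thesis by (rule that)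
qed

lemma net_equiv_if_common_affixes:
  assumes long: "\<And>\<epsilon>. \<epsilon> \<in> {0<..1} \<Longrightarrow> 1 / \<epsilon> \<le> real (length (p \<epsilon>)) \<and> 1 / \<epsilon> \<le> real (length (s \<epsilon>))"
    and pre: "\<And>\<epsilon>. prefix (p \<epsilon>) (u \<epsilon>) \<and> prefix (p \<epsilon>) (v \<epsilon>)"
    and suf: "\<And>\<epsilon>. suffix (s \<epsilon>) (u \<epsilon>) \<and> suffix (s \<epsilon>) (v \<epsilon>)"
  shows "net_equiv u v"
  unfolding net_equiv_def
proof
  fix m :: nat
  have "eventually (\<lambda>\<epsilon>. real m * log 2 (1 / \<epsilon>) \<le> 1 / \<epsilon>) (at_right 0)"
    by real_asymp
  then obtain d where "d > 0" and d: "\<And>\<epsilon>. 0 < \<epsilon> \<Longrightarrow> \<epsilon> < d \<Longrightarrow> real m * log 2 (1 / \<epsilon>) \<le> 1 / \<epsilon>"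
    unfolding eventually_at_right_field by blast
  have "ereal (real m * log 2 (1 / \<epsilon>)) \<le> ereal_of_enat (min (lcp (u \<epsilon>) (v \<epsilon>)) (lcs (u \<epsilon>) (v \<epsilon>)))"
    if "\<epsilon> \<in> {0<..1}" "\<epsilon> < d" for \<epsilon>
  proof -
    have "enat (length (p \<epsilon>)) \<le> lcp (u \<epsilon>) (v \<epsilon>)"
      using pre unfolding enat_le_lcp_iff by blast
    moreover have "enat (length (s \<epsilon>)) \<le> lcs (u \<epsilon>) (v \<epsilon>)"
      using suf unfolding lcs_eq_lcp_rev enat_le_lcp_iff suffix_to_prefix by (metis length_rev)
    ultimately have "ereal_of_enat (enat (min (length (p \<epsilon>)) (length (s \<epsilon>))))
        \<le> ereal_of_enat (min (lcp (u \<epsilon>) (v \<epsilon>)) (lcs (u \<epsilon>) (v \<epsilon>)))"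
      unfolding ereal_of_enat_le_iff
      by (metis enat_ord_simps(1) min.bounded_iff min.cobounded1 min.cobounded2 order_trans)
    moreover have "real m * log 2 (1 / \<epsilon>) \<le> real (min (length (p \<epsilon>)) (length (s \<epsilon>)))"
      using d[of \<epsilon>] long[of \<epsilon>] that by (auto simp: min_def)
    ultimately show ?thesis
      by (metis ereal_less_eq(3) ereal_of_enat_simps(1) order_trans)
  qed
  with \<open>d > 0\<close> show "\<exists>\<epsilon>\<^sub>0>0. \<forall>\<epsilon>\<in>{0<..1}. \<epsilon> < \<epsilon>\<^sub>0 \<longrightarrow> ereal (real m * log 2 (1 / \<epsilon>))
      \<le> ereal_of_enat (min (lcp (u \<epsilon>) (v \<epsilon>)) (lcs (u \<epsilon>) (v \<epsilon>)))"
    by blast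
qed

lemma abs_gen_word_eq_iff:
  assumes "moderate u" "moderate v"
  shows "abs_gen_word u = abs_gen_word v \<longleftrightarrow> net_equiv u v"
  using Quotient_rel[OF Quotient_gen_word, of u v] assms net_equiv_refl
  unfolding moderate_equiv_def by blast

lemma abs_gen_word_times:
  assumes "moderate u" "moderate v"
  shows "abs_gen_word u * abs_gen_word v = abs_gen_word (\<lambda>\<epsilon>. u \<epsilon> @ v \<epsilon>)"
  using assms by (intro times_gen_word.abs_eq) (simp_all add: moderate_equiv_def net_equiv_refl)

lemma gen_word_representative:
  obtains u where "moderate u" "x = abs_gen_word u"
  by (metis Quotient_abs_rep[OF Quotient_gen_word] Quotient_rep_reflp[OF Quotient_gen_word]
      moderate_equiv_def)

lemma embed_append: "\<iota> (u @ v) = \<iota> u * \<iota> v"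
  by (simp add: embed.abs_eq abs_gen_word_times moderate_const)

lemma gen_prefix_refl: "x \<preceq> x"
  unfolding gen_prefix_def by (metis mult_1_right)

lemma gen_prefix_trans: "x \<preceq> y \<Longrightarrow> y \<preceq> z \<Longrightarrow> x \<preceq> z"
  unfolding gen_prefix_def by (metis mult.assoc)

lemma gen_prefix_mult_left: "x \<preceq> y \<Longrightarrow> q * x \<preceq> q * y"
  unfolding gen_prefix_def by (metis mult.assoc)

lemma embed_gen_prefix_iff: "\<iota> u \<preceq> \<iota> v \<longleftrightarrow> prefix u v"
proof
  assume "prefix u v"
  then show "\<iota> u \<preceq> \<iota> v"
    unfolding gen_prefix_def prefix_def using embed_append by blast
next
  assume "\<iota> u \<preceq> \<iota> v"
  then obtain x where "\<iota> v = \<iota> u * x"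
    unfolding gen_prefix_def by blast
  moreover obtain p where p: "moderate p" "x = abs_gen_word p"
    by (rule gen_word_representative)
  ultimately have "abs_gen_word (\<lambda>_. v) = abs_gen_word (\<lambda>\<epsilon>. u @ p \<epsilon>)"
    by (simp add: embed.abs_eq abs_gen_word_times moderate_const)
  then have "net_equiv (\<lambda>_. v) (\<lambda>\<epsilon>. u @ p \<epsilon>)"
    using p by (simp add: abs_gen_word_eq_iff moderate_append moderate_const)
  then obtain \<epsilon> where "v = u @ p \<epsilon>"
    by (rule net_equiv_imp_eq[where k = "length v"]) (rule min.coboundedI1[OF lcp_le_length])
  then show "prefix u v"
    by (rule prefixI)
qed

definition long_power :: "'a \<Rightarrow> 'a net" where
  "long_power a \<epsilon> = replicate (nat \<lceil>1 / \<epsilon>\<rceil>) a"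

lemma length_long_power: "1 / \<epsilon> \<le> real (length (long_power a \<epsilon>))"
  unfolding long_power_def by (simp add: real_nat_ceiling_ge)

lemma moderate_long_power: "moderate (long_power a)"
  unfolding moderate_def
proof (intro exI conjI ballI impI)
  fix \<epsilon> :: real assume "\<epsilon> \<in> {0<..1}" "\<epsilon> < 1"
  then have "1 \<le> 1 / \<epsilon>" by simp
  then have "real (nat \<lceil>1 / \<epsilon>\<rceil>) \<le> 2 / \<epsilon>" by linarith
  then show "real (length (long_power a \<epsilon>)) \<le> 2 / \<epsilon> ^ 1"
    by (simp add: long_power_def)
qed auto

text \<open>The witnesses are \<open>x = a\<^sup>n\<close> and \<open>y = a\<^sup>n b\<close>: the block \<open>a\<^sup>n\<close> is both a prefix and a suffix of
  \<open>y * x = a\<^sup>n b a\<^sup>n\<close>, which makes that product indistinguishable from \<open>x\<close>.\<close>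

lemma gen_prefix_not_antisym:
  fixes a b :: 'a
  assumes "a \<noteq> b"
  shows "\<exists>x y :: 'a gen_word. x \<preceq> y \<and> y \<preceq> x \<and> x \<noteq> y"
proof -
  let ?A = "long_power a"
  let ?x = "abs_gen_word ?A"
  have mod: "moderate (\<lambda>\<epsilon>. ?A \<epsilon> @ [b])"
    by (rule moderate_append[OF moderate_long_power moderate_const])
  have y: "?x * \<iota> [b] = abs_gen_word (\<lambda>\<epsilon>. ?A \<epsilon> @ [b])"
    by (simp add: embed.abs_eq abs_gen_word_times moderate_const moderate_long_power)
  have "net_equiv ?A (\<lambda>\<epsilon>. (?A \<epsilon> @ [b]) @ ?A \<epsilon>)"
    by (rule net_equiv_if_common_affixes[where p = ?A and s = ?A])
      (simp_all add: length_long_power, simp add: suffix_def)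
  then have "?x = ?x * \<iota> [b] * ?x"
    unfolding y using mod moderate_append[OF mod moderate_long_power]
    by (simp add: abs_gen_word_times abs_gen_word_eq_iff moderate_long_power)
  then have "?x * \<iota> [b] \<preceq> ?x" "?x \<preceq> ?x * \<iota> [b]"
    unfolding gen_prefix_def by blast+
  moreover have "?x \<noteq> ?x * \<iota> [b]"
  proof
    assume "?x = ?x * \<iota> [b]"
    then have "net_equiv ?A (\<lambda>\<epsilon>. ?A \<epsilon> @ [b])"
      unfolding y using mod by (simp add: abs_gen_word_eq_iff moderate_long_power)
    moreover have "min (lcp (?A \<epsilon>) (?A \<epsilon> @ [b])) (lcs (?A \<epsilon>) (?A \<epsilon> @ [b])) \<le> enat 0" for \<epsilon>
    proof -
      have "longest_common_prefix (replicate n a) (b # replicate n a) = []" for n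
        using assms by (cases n) auto
      then show ?thesis
        by (simp add: lcs_eq_lcp_rev lcp_def long_power_def)
    qed
    ultimately obtain \<epsilon> where "?A \<epsilon> = ?A \<epsilon> @ [b]"
      by (rule net_equiv_imp_eq)
    then show False by simp
  qed
  ultimately show ?thesis by blast
qed

theorem mainTheorem9:
  shows
    "(reflp ((\<preceq>) :: 'a::finite gen_word \<Rightarrow> 'a gen_word \<Rightarrow> bool) \<and>
      transp ((\<preceq>) :: 'a gen_word \<Rightarrow> 'a gen_word \<Rightarrow> bool) \<and>
      (\<forall>x y q :: 'a gen_word. x \<preceq> y \<longrightarrow> q * x \<preceq> q * y)) \<and>
     (\<forall>u v :: 'a list. \<iota> u \<preceq> \<iota> v \<longleftrightarrow> prefix u v) \<and>
     (\<forall>a b :: 'a. a \<noteq> b \<and> UNIV = {a, b} \<longrightarrow>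
        \<not> antisymp ((\<preceq>) :: 'a gen_word \<Rightarrow> 'a gen_word \<Rightarrow> bool)) \<and>
     (\<forall>a b :: 'a. a \<noteq> b \<and> UNIV = {a, b} \<longrightarrow>
        \<not> (\<forall>x y q :: 'a gen_word. x \<preceq> y \<longrightarrow> x * q \<preceq> y * q) \<and>
        \<iota> [a] \<preceq> \<iota> [a, b] \<and> \<not> \<iota> [a, a] \<preceq> \<iota> [a, b, a])"
proof (intro conjI allI impI)
  show "reflp ((\<preceq>) :: 'a gen_word \<Rightarrow> _)"
    by (rule reflpI) (rule gen_prefix_refl)
  show "transp ((\<preceq>) :: 'a gen_word \<Rightarrow> _)"
    by (rule transpI) (rule gen_prefix_trans)
  show "q * x \<preceq> q * y" if "x \<preceq> y" for x y q :: "'a gen_word"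
    using that by (rule gen_prefix_mult_left)
  show "\<iota> u \<preceq> \<iota> v \<longleftrightarrow> prefix u v" for u v :: "'a list"
    by (rule embed_gen_prefix_iff)
next
  fix a b :: 'a assume "a \<noteq> b \<and> UNIV = {a, b}"
  then show "\<not> antisymp ((\<preceq>) :: 'a gen_word \<Rightarrow> _)"
    using gen_prefix_not_antisym[of a b] by (auto dest: antisympD)
next
  fix a b :: 'a assume ab: "a \<noteq> b \<and> UNIV = {a, b}"
  show le: "\<iota> [a] \<preceq> \<iota> [a, b]" and nle: "\<not> \<iota> [a, a] \<preceq> \<iota> [a, b, a]"
    using ab by (simp_all add: embed_gen_prefix_iff)
  show "\<not> (\<forall>x y q :: 'a gen_word. x \<preceq> y \<longrightarrow> x * q \<preceq> y * q)"
    using le nle embed_append[of "[a]" "[a]"] embed_append[of "[a, b]" "[a]"] by force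
qed

end
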